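(* Consider the MAX cost on an $s$–$t$ graph $G$ with $n\ge1$ agents, $k\ge1$ interceptors and $\alpha>0$ with $\alpha>\frac{|p_{max}|-|p_{min}|}{k}$. When minimizing $F_n(\cdot,\alpha)$ over $(\Delta(P_{st}))^n$ one can restrict to iid distributions, i.e. products $X^n$ of $n$ copies of a distribution $X\in\Delta(P_{st})$: $$\min_{\sigma\in(\Delta(P_{st}))^n}F_n(\sigma,\alpha)=\min_{X\in\Delta(P_{st})}F_n(X^n,\alpha).$$
   Context: Graph: $G=(V,E,s,t)$ is a finite directed acyclic multigraph ($E$ is a multiset) with source $s$ and sink $t\neq s$, such that $E\ne\emptyset$ and every edge lies on some directed $s$–$t$ path. $P_{st}$ is the set of directed $s$–$t$ paths; a path is treated as a set of edges and $|p|$ is its number of edges. $p_{max},p_{min}$ are a longest and a shortest path in $P_{st}$. Strategies: each of the $n$ agents picks a path, giving $a=(a_1,\dots,a_n)\in(P_{st})^n$; the $k$ interceptors pick $d=(d_1,\dots,d_k)\in E^k$. $\Delta X$ is the set of probability distributions on $X$. An element $\sigma=(\sigma_1,\dots,\sigma_n)\in(\Delta(P_{st}))^n$ is identified with the product distribution on $(P_{st})^n$. MAX cost: $C(a,d,\alpha)=\max_{i\in[n]}\left(|a_i|+\alpha\sum_{j\in[k]}\mathbf 1\{d_j\in a_i\}\right)$, and $F_n(\sigma,\alpha)=\max_{d\in E^k}\mathbb{E}_{a\sim\sigma}[C(a,d,\alpha)]$. *)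

theory Defs
  imports "Graph_Theory.Arc_Walk" "HOL-Probability.Probability"
begin

text \<open>A path is identified with its set of edges. This loses nothing on an acyclic graph: there the
  edges of a directed path are pairwise distinct and determine their order.\<close>

definition st_paths :: "('v, 'e) pre_digraph \<Rightarrow> 'v \<Rightarrow> 'v \<Rightarrow> 'e set set" where
  "st_paths G s t = {set w | w. pre_digraph.apath G s w t}"

locale st_graph = fin_digraph G for G :: "('v, 'e) pre_digraph" (structure) +
  fixes s t :: 'v
  assumes acyclic: "\<nexists>c. cycle c"
    and s_in_verts: "s \<in> verts G"
    and t_in_verts: "t \<in> verts G"
    and s_neq_t: "t \<noteq> s"
    and arcs_nonempty: "arcs G \<noteq> {}"
    and arc_on_st_path: "\<And>e. e \<in> arcs G \<Longrightarrow> \<exists>p \<in> st_paths G s t. e \<in> p"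

definition distributions :: "'a set \<Rightarrow> 'a pmf set" where
  "distributions S = {X. set_pmf X \<subseteq> S}"

text \<open>Agents are indexed by \<open>{..<n}\<close> and interceptors by \<open>{..<k}\<close>; tuples are functions on these index
  sets that are \<open>undefined\<close> elsewhere.\<close>

definition max_cost :: "nat \<Rightarrow> nat \<Rightarrow> (nat \<Rightarrow> 'e set) \<Rightarrow> (nat \<Rightarrow> 'e) \<Rightarrow> real \<Rightarrow> real" where
  "max_cost n k a d \<alpha> = (MAX i\<in>{..<n}. real (card (a i)) + \<alpha> * (\<Sum>j<k. of_bool (d j \<in> a i)))"

definition worst_cost ::
  "('v, 'e) pre_digraph \<Rightarrow> nat \<Rightarrow> nat \<Rightarrow> (nat \<Rightarrow> 'e set pmf) \<Rightarrow> real \<Rightarrow> real" where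
  "worst_cost G n k \<sigma> \<alpha> =
     (MAX d \<in> {..<k} \<rightarrow>\<^sub>E arcs G.
        measure_pmf.expectation (Pi_pmf {..<n} undefined \<sigma>) (\<lambda>a. max_cost n k a d \<alpha>))"

definition iid :: "nat \<Rightarrow> 'a pmf \<Rightarrow> nat \<Rightarrow> 'a pmf" where
  "iid n X = (\<lambda>i\<in>{..<n}. X)"

end

theory Submission
  imports Defs
begin

text \<open>Fix an interception \<open>d\<close> and let \<open>c p\<close> be the cost of an agent on the path \<open>p\<close>. By independence
  \<open>P(max\<^sub>i c(a\<^sub>i) \<le> t) = \<Prod>\<^sub>i \<sigma>\<^sub>i(c \<le> t)\<close>. Replacing every \<open>\<sigma>\<^sub>i\<close> by the average \<open>X = (\<sigma>\<^sub>1 + \<dots> + \<sigma>\<^sub>n)/n\<close>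
  can only increase this product, by AM-GM, so the maximum becomes stochastically smaller and its
  expectation does not increase. This holds for every \<open>d\<close>, hence also for the worst one. A best \<open>X\<close>
  exists because the simplex of distributions is compact and the cost is continuous in \<open>X\<close>.\<close>

text \<open>Both expectations equal the same constant minus the same nonnegative combination of
  values of the distribution functions, which the hypothesis compares ray by ray.\<close>

lemma expectation_le_stochastic_dominance:
  fixes f :: "'a \<Rightarrow> real" and g :: "'b \<Rightarrow> real"
  assumes fin: "finite (set_pmf M)" "finite (set_pmf N)"
    and dom: "\<And>t. measure_pmf.prob M {x. f x \<le> t} \<le> measure_pmf.prob N {x. g x \<le> t}"
  shows "measure_pmf.expectation N g \<le> measure_pmf.expectation M f"
proof -
  \<comment> \<open>On a finite set, the identity is a constant minus a nonnegative combination of indicators of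
    lower rays; the weights are the gaps between consecutive elements.\<close>
  have layers: "\<exists>c w. (\<forall>v. w v \<ge> 0) \<and> (\<forall>x\<in>V. x = c - (\<Sum>v\<in>V. w v * of_bool (x \<le> v)))"
    if "finite V" for V :: "real set"
    using that
  proof (induction rule: finite_linorder_min_induct)
    case empty
    then show ?case by (auto intro: exI[of _ "\<lambda>_. 0"])
  next
    case (insert b A)
    then obtain c w where w: "\<forall>v. w v \<ge> 0"
      and c: "\<And>x. x \<in> A \<Longrightarrow> x = c - (\<Sum>v\<in>A. w v * of_bool (x \<le> v))" by blast
    have bA: "b \<notin> A" using insert by auto
    show ?case
    proof (cases "A = {}")
      case True
      then show ?thesis by (intro exI[of _ b] exI[of _ "\<lambda>_. 0"]) auto
    next
      case False
      \<comment> \<open>All of \<open>A\<close> lies above \<open>b\<close>, so at \<open>b\<close>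
        the old formula yields \<open>Min A\<close>. The weight \<open>Min A - b\<close> lowers this
        to \<open>b\<close>, and its indicator vanishes on \<open>A\<close>.\<close>
      define w' where "w' = w(b := Min A - b)"
      have "Min A = c - (\<Sum>v\<in>A. w v * of_bool (Min A \<le> v))"
        using False insert by (intro c) auto
      also have "(\<Sum>v\<in>A. w v * of_bool (Min A \<le> v)) = (\<Sum>v\<in>A. w v)"
        using insert by (intro sum.cong) auto
      finally have MinA: "Min A = c - (\<Sum>v\<in>A. w v)" .
      have w'A: "(\<Sum>v\<in>A. w' v * of_bool (x \<le> v)) = (\<Sum>v\<in>A. w v * of_bool (x \<le> v))" for x
        using bA by (intro sum.cong) (auto simp: w'_def)
      have "x = c - (\<Sum>v\<in>insert b A. w' v * of_bool (x \<le> v))" if "x \<in> insert b A" for x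
      proof (cases "x = b")
        case True
        have "(\<Sum>v\<in>A. w v * of_bool (b \<le> v)) = (\<Sum>v\<in>A. w v)"
          using insert by (intro sum.cong) (auto simp: less_imp_le)
        then show ?thesis using True bA insert w'A[of b] MinA by (simp add: w'_def)
      next
        case False
        then have "x \<in> A" "\<not> x \<le> b" using that insert by auto
        then show ?thesis using bA insert w'A[of x] c[of x] \<open>x \<in> A\<close> \<open>\<not> x \<le> b\<close> by (simp del: sum_mult_of_bool_eq)
      qed
      moreover have "\<forall>v. w' v \<ge> 0"
        using w insert False by (auto simp: w'_def less_imp_le)
      ultimately show ?thesis by blast
    qed
  qed
  \<comment> \<open>Collecting the values of both functions makes one choice of \<open>c\<close> and
    \<open>w\<close> serve \<open>f\<close> and \<open>g\<close> alike.\<close>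
  define V where "V = f ` set_pmf M \<union> g ` set_pmf N"
  have "finite V" using fin by (simp add: V_def)
  from layers[OF this] obtain c w where w: "\<And>v. w v \<ge> 0"
    and c: "\<And>x. x \<in> V \<Longrightarrow> x = c - (\<Sum>v\<in>V. w v * of_bool (x \<le> v))" by blast
  \<comment> \<open>The fresh type \<open>'c\<close> lets this apply to both \<open>M\<close> and
    \<open>N\<close>.\<close>
  have expand: "measure_pmf.expectation P h = c - (\<Sum>v\<in>V. w v * measure_pmf.prob P {x. h x \<le> v})"
    if fP: "finite (set_pmf P)" and hV: "h ` set_pmf P \<subseteq> V" for P :: "'c pmf" and h
  proof -
    note [simp] = integrable_measure_pmf_finite[OF fP]
    have "measure_pmf.expectation P h
        = measure_pmf.expectation P (\<lambda>x. c - (\<Sum>v\<in>V. w v * indicator {x. h x \<le> v} x))"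
      using hV c by (intro integral_cong_AE) (auto simp: AE_measure_pmf_iff indicator_def of_bool_def)
    also have "\<dots> = c - (\<Sum>v\<in>V. w v * measure_pmf.prob P {x. h x \<le> v})"
      by (simp add: Bochner_Integration.integral_sum)
    finally show ?thesis .
  qed
  show ?thesis
    using w dom
    by (subst (1 2) expand) (auto simp: V_def fin intro!: sum_mono mult_left_mono)
qed

text \<open>AM-GM with the root cleared, to be compared with a product of equal
  probabilities.\<close>

lemma prod_le_average_power:
  fixes x :: "'a \<Rightarrow> real"
  assumes "finite S" "S \<noteq> {}" and x: "\<And>i. i \<in> S \<Longrightarrow> x i \<ge> 0"
  shows "(\<Prod>i\<in>S. x i) \<le> ((\<Sum>i\<in>S. x i) / card S) ^ card S"
proof -
  have c: "card S > 0" using assms by (simp add: card_gt_0_iff)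
  have p: "(\<Prod>i\<in>S. x i) \<ge> 0" using x by (simp add: prod_nonneg)
  have "(\<Prod>i\<in>S. x i) = ((\<Prod>i\<in>S. x i) powr (1 / card S)) ^ card S"
    using c p by (cases "(\<Prod>i\<in>S. x i) = 0") (simp_all add: powr_power)
  also have "\<dots> \<le> (\<Sum>i\<in>S. x i / card S) ^ card S"
    using arith_geom_mean[OF assms] by (intro power_mono) auto
  finally show ?thesis by (simp add: sum_divide_distrib)
qed

text \<open>Drawing a uniform index \<open>i\<close> and then sampling from
  \<open>\<sigma> i\<close> realizes the average of the strategies.\<close>

lemma expectation_Max_average_le:
  fixes c :: "'a \<Rightarrow> real"
  assumes n: "n \<ge> 1" and fin: "\<And>i. i < n \<Longrightarrow> finite (set_pmf (\<sigma> i))"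
  defines "X \<equiv> pmf_of_set {..<n} \<bind> \<sigma>"
  shows "measure_pmf.expectation (Pi_pmf {..<n} dflt (iid n X)) (\<lambda>a. MAX i\<in>{..<n}. c (a i))
    \<le> measure_pmf.expectation (Pi_pmf {..<n} dflt \<sigma>) (\<lambda>a. MAX i\<in>{..<n}. c (a i))"
proof (rule expectation_le_stochastic_dominance)
  have ne: "{..<n} \<noteq> {}" using n by (auto simp: lessThan_empty_iff)
  have "finite (set_pmf X)"
    using fin ne by (auto simp: X_def)
  then show "finite (set_pmf (Pi_pmf {..<n} dflt (iid n X)))"
    by (subst set_Pi_pmf) (auto simp: iid_def intro!: finite_PiE_dflt)
  show "finite (set_pmf (Pi_pmf {..<n} dflt \<sigma>))"
    using fin by (subst set_Pi_pmf) (auto intro!: finite_PiE_dflt)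
  fix t
  let ?B = "{p. c p \<le> t}"
  \<comment> \<open>A maximum is at most \<open>t\<close> iff every coordinate lies in
    \<open>?B\<close>; the event is a box, so independence turns its probability into a
    product.\<close>
  have ev: "{a. (MAX i\<in>{..<n}. c (a i)) \<le> t} = Pi {..<n} (\<lambda>_. ?B)"
    using ne by (auto simp: Pi_def)
  have "measure_pmf.prob X ?B = measure_pmf.expectation X (indicator ?B)" by simp
  also have "\<dots> = (\<Sum>i<n. measure_pmf.prob (\<sigma> i) ?B) / n"
    unfolding X_def using fin ne
    by (subst pmf_expectation_bind_pmf_of_set) (auto simp: sum_divide_distrib field_simps)
  finally have avg: "measure_pmf.prob X ?B = (\<Sum>i<n. measure_pmf.prob (\<sigma> i) ?B) / n" .
  have "(\<Prod>i<n. measure_pmf.prob (\<sigma> i) ?B) \<le> measure_pmf.prob X ?B ^ n"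
    using prod_le_average_power[of "{..<n}" "\<lambda>i. measure_pmf.prob (\<sigma> i) ?B"] ne by (simp add: avg)
  also have "\<dots> = (\<Prod>i<n. measure_pmf.prob (iid n X i) ?B)"
    by (simp add: iid_def)
  finally show "measure_pmf.prob (Pi_pmf {..<n} dflt \<sigma>) {a. (MAX i\<in>{..<n}. c (a i)) \<le> t}
      \<le> measure_pmf.prob (Pi_pmf {..<n} dflt (iid n X)) {a. (MAX i\<in>{..<n}. c (a i)) \<le> t}"
    by (simp add: ev measure_Pi_pmf_Pi)
qed

text \<open>A closed subset of a product of compact sets (Tychonoff). Functions are total, like
  \<open>pmf X\<close>, so the factors outside \<open>S\<close> are \<open>{0}\<close>.\<close>

lemma compact_simplex:
  assumes "finite S"
  shows "compact {f :: 'a \<Rightarrow> real. (\<forall>x. 0 \<le> f x) \<and> (\<forall>x. x \<notin> S \<longrightarrow> f x = 0) \<and> sum f S = 1}"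
    (is "compact ?K")
proof -
  let ?I = "\<lambda>x. if x \<in> S then {0..1::real} else {0}"
  have "compactin (product_topology (\<lambda>_. euclidean) UNIV) (PiE UNIV ?I)"
    by (subst compactin_PiE) auto
  then have "compact (PiE UNIV ?I)"
    by (simp add: euclidean_product_topology)
  moreover have "closed {f :: 'a \<Rightarrow> real. sum f S = 1}"
    by (intro closed_Collect_eq continuous_intros continuous_on_product_coordinates)
  \<comment> \<open>The upper bound of the box comes for free from nonnegativity and total mass
    1.\<close>
  moreover have "f x \<le> 1" if "\<And>x. 0 \<le> f x" "sum f S = 1" "x \<in> S" for f :: "'a \<Rightarrow> real" and x
    using member_le_sum[of x S f] that assms by auto
  then have "?K = PiE UNIV ?I \<inter> {f. sum f S = 1}"
    by (auto simp: PiE_def Pi_def split: if_splits) (metis order.refl)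
  ultimately show ?thesis by (simp add: compact_Int_closed)
qed

text \<open>The minimum is found among mass functions, where compactness and continuity apply, and
  carried back by \<open>embed_pmf\<close>.\<close>

lemma distributions_attain_inf:
  fixes F :: "'a pmf \<Rightarrow> real"
  assumes S: "finite S" "S \<noteq> {}"
    and F: "\<And>X. X \<in> distributions S \<Longrightarrow> F X = g (pmf X)"
    and g: "continuous_on UNIV g"
  obtains X where "X \<in> distributions S" "\<And>Y. Y \<in> distributions S \<Longrightarrow> F X \<le> F Y"
proof -
  let ?K = "{f :: 'a \<Rightarrow> real. (\<forall>x. 0 \<le> f x) \<and> (\<forall>x. x \<notin> S \<longrightarrow> f x = 0) \<and> sum f S = 1}"
  have K: "pmf Y \<in> ?K" if "Y \<in> distributions S" for Y
    using that S by (auto simp: distributions_def sum_pmf_eq_1 pmf_eq_0_set_pmf)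
  obtain s where "s \<in> S" using S by blast
  then have "?K \<noteq> {}"
    using K[of "return_pmf s"] by (auto simp: distributions_def)
  with continuous_attains_inf[OF compact_simplex[OF S(1)], of g] g
  obtain f where f: "f \<in> ?K" "\<And>h. h \<in> ?K \<Longrightarrow> g f \<le> g h"
    by (metis (no_types, lifting) continuous_on_subset subset_UNIV)
  \<comment> \<open>Total mass 1 over the whole type is what makes \<open>f\<close> the mass
    function of \<open>embed_pmf f\<close>.\<close>
  have "(\<integral>\<^sup>+x. ennreal (f x) \<partial>count_space UNIV) = (\<integral>\<^sup>+x. ennreal (f x) \<partial>count_space S)"
    using f(1) by (intro nn_integral_count_space_eq) auto
  also have "\<dots> = 1"
    using f(1) S by (simp add: nn_integral_count_space_finite sum_ennreal)
  finally have pf: "pmf (embed_pmf f) x = f x" for x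
    using f(1) by (intro pmf_embed_pmf) auto
  then have pf': "pmf (embed_pmf f) = f" by auto
  have D: "embed_pmf f \<in> distributions S"
    using f(1) by (auto simp: distributions_def set_pmf_eq pf)
  show thesis
  proof
    show "embed_pmf f \<in> distributions S" by (fact D)
    show "F (embed_pmf f) \<le> F Y" if "Y \<in> distributions S" for Y
      using f(2)[OF K[OF that]] by (simp add: F[OF D] F[OF that] pf')
  qed
qed

lemma continuous_on_Max:
  fixes f :: "'i \<Rightarrow> 'a::topological_space \<Rightarrow> 'b::linorder_topology"
  assumes "finite I" "I \<noteq> {}" "\<And>i. i \<in> I \<Longrightarrow> continuous_on A (f i)"
  shows "continuous_on A (\<lambda>x. MAX i\<in>I. f i x)"
  using assms
  by (induction I rule: finite_ne_induct) (simp_all add: continuous_on_max)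

text \<open>Summing over all profiles in \<open>S\<close>, not just the support, gives one
  polynomial in the masses valid for every \<open>X\<close>; continuity follows from this
  form.\<close>

lemma expectation_Pi_iid:
  fixes h :: "(nat \<Rightarrow> 'a) \<Rightarrow> real"
  assumes S: "finite S" and X: "X \<in> distributions S"
  shows "measure_pmf.expectation (Pi_pmf {..<n} dflt (iid n X)) h
    = (\<Sum>a\<in>PiE_dflt {..<n} dflt (\<lambda>_. S). (\<Prod>i<n. pmf X (a i)) * h a)"
proof -
  have "finite (PiE_dflt {..<n} dflt (\<lambda>_. S))"
    using S by (intro finite_PiE_dflt) auto
  then have "measure_pmf.expectation (Pi_pmf {..<n} dflt (iid n X)) h
    = (\<Sum>a\<in>PiE_dflt {..<n} dflt (\<lambda>_. S). pmf (Pi_pmf {..<n} dflt (iid n X)) a *\<^sub>R h a)"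
    by (rule integral_measure_pmf)
       (use X in \<open>auto simp: set_Pi_pmf PiE_dflt_def iid_def distributions_def\<close>)
  also have "\<dots> = (\<Sum>a\<in>PiE_dflt {..<n} dflt (\<lambda>_. S). (\<Prod>i<n. pmf X (a i)) * h a)"
    by (intro sum.cong refl) (auto simp: pmf_Pi PiE_dflt_def iid_def)
  finally show ?thesis .
qed

context st_graph
begin

lemma finite_st_paths: "finite (st_paths G s t)"
proof (rule finite_subset)
  show "st_paths G s t \<subseteq> Pow (arcs G)"
    by (auto simp: st_paths_def apath_def awalk_def)
qed simp

lemma st_paths_nonempty: "st_paths G s t \<noteq> {}"
  using arcs_nonempty arc_on_st_path by blast

lemma finite_interceptions: "finite ({..<k::nat} \<rightarrow>\<^sub>E arcs G)"
  by (intro finite_PiE) auto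

lemma interceptions_nonempty: "({..<k::nat} \<rightarrow>\<^sub>E arcs G) \<noteq> {}"
  using arcs_nonempty by (simp add: PiE_eq_empty_iff)

lemma worst_cost_iid_average_le:
  assumes "n \<ge> 1" and \<sigma>: "\<sigma> \<in> {..<n} \<rightarrow>\<^sub>E distributions (st_paths G s t)"
  shows "worst_cost G n k (iid n (pmf_of_set {..<n} \<bind> \<sigma>)) \<alpha> \<le> worst_cost G n k \<sigma> \<alpha>"
proof -
  have fin: "finite (set_pmf (\<sigma> i))" if "i < n" for i
    using \<sigma> that finite_st_paths by (auto simp: distributions_def intro: finite_subset dest!: PiE_mem)
  show ?thesis
    unfolding worst_cost_def
  proof (rule Max.boundedI, goal_cases)
    case (3 y)
    then obtain d where d: "d \<in> {..<k} \<rightarrow>\<^sub>E arcs G"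
      and y: "y = measure_pmf.expectation
        (Pi_pmf {..<n} undefined (iid n (pmf_of_set {..<n} \<bind> \<sigma>))) (\<lambda>a. max_cost n k a d \<alpha>)"
      by blast
    \<comment> \<open>For fixed \<open>d\<close> each agent's cost is a function of its own path
      alone, the same function for all agents.\<close>
    have "y \<le> measure_pmf.expectation (Pi_pmf {..<n} undefined \<sigma>) (\<lambda>a. max_cost n k a d \<alpha>)"
      unfolding y max_cost_def by (rule expectation_Max_average_le[OF assms(1) fin])
    also have "\<dots> \<le> (MAX d \<in> {..<k} \<rightarrow>\<^sub>E arcs G.
        measure_pmf.expectation (Pi_pmf {..<n} undefined \<sigma>) (\<lambda>a. max_cost n k a d \<alpha>))"
      using d finite_interceptions by (intro Max_ge) auto
    finally show ?case .
  qed (use finite_interceptions interceptions_nonempty in auto)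
qed

text \<open>The cost is a maximum of finitely many polynomials in the masses of \<open>X\<close>,
  hence continuous.\<close>

lemma worst_cost_iid_attains_inf:
  obtains X where "X \<in> distributions (st_paths G s t)"
    "\<And>Y. Y \<in> distributions (st_paths G s t) \<Longrightarrow>
      worst_cost G n k (iid n X) \<alpha> \<le> worst_cost G n k (iid n Y) \<alpha>"
proof (rule distributions_attain_inf[OF finite_st_paths st_paths_nonempty,
      of "\<lambda>X. worst_cost G n k (iid n X) \<alpha>"])
  let ?P = "PiE_dflt {..<n} undefined (\<lambda>_. st_paths G s t)"
  show "worst_cost G n k (iid n X) \<alpha> = (\<lambda>f. MAX d \<in> {..<k} \<rightarrow>\<^sub>E arcs G.
      \<Sum>a\<in>?P. (\<Prod>i<n. f (a i)) * max_cost n k a d \<alpha>) (pmf X)"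
    if "X \<in> distributions (st_paths G s t)" for X
    using that by (simp add: worst_cost_def expectation_Pi_iid[OF finite_st_paths])
  show "continuous_on UNIV (\<lambda>f :: 'e set \<Rightarrow> real. MAX d \<in> {..<k} \<rightarrow>\<^sub>E arcs G.
      \<Sum>a\<in>?P. (\<Prod>i<n. f (a i)) * max_cost n k a d \<alpha>)"
    by (intro continuous_on_Max finite_interceptions interceptions_nonempty continuous_intros
        continuous_on_product_coordinates)
qed (rule that)

end

theorem lemma13:
  fixes G :: "('v, 'e) pre_digraph" and s t :: 'v
    and n k :: nat and \<alpha> :: real and p_max p_min :: "'e set"
  assumes "st_graph G s t"
    and "n \<ge> 1" and "k \<ge> 1"
    and "is_arg_max card (\<lambda>p. p \<in> st_paths G s t) p_max"
    and "is_arg_min card (\<lambda>p. p \<in> st_paths G s t) p_min"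
    and "\<alpha> > 0"
    and "\<alpha> > (real (card p_max) - real (card p_min)) / real k"
  shows "\<exists>\<sigma> X.
      is_arg_min (\<lambda>\<sigma>. worst_cost G n k \<sigma> \<alpha>)
        (\<lambda>\<sigma>. \<sigma> \<in> {..<n} \<rightarrow>\<^sub>E distributions (st_paths G s t)) \<sigma> \<and>
      is_arg_min (\<lambda>X. worst_cost G n k (iid n X) \<alpha>)
        (\<lambda>X. X \<in> distributions (st_paths G s t)) X \<and>
      worst_cost G n k \<sigma> \<alpha> = worst_cost G n k (iid n X) \<alpha>"
proof -
  interpret st_graph G s t by fact
  let ?D = "distributions (st_paths G s t)"
  obtain X where X: "X \<in> ?D"
    and min: "\<And>Y. Y \<in> ?D \<Longrightarrow> worst_cost G n k (iid n X) \<alpha> \<le> worst_cost G n k (iid n Y) \<alpha>"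
    by (rule worst_cost_iid_attains_inf[of n k \<alpha>]) (rule that)
  have "worst_cost G n k (iid n X) \<alpha> \<le> worst_cost G n k \<sigma> \<alpha>" if \<sigma>: "\<sigma> \<in> {..<n} \<rightarrow>\<^sub>E ?D" for \<sigma>
  proof -
    have "{..<n} \<noteq> {}" using \<open>n \<ge> 1\<close> by (auto simp: lessThan_empty_iff)
    then have "pmf_of_set {..<n} \<bind> \<sigma> \<in> ?D"
      using \<sigma> by (auto simp: distributions_def PiE_def Pi_def set_bind_pmf)
    from min[OF this] worst_cost_iid_average_le[OF \<open>n \<ge> 1\<close> \<sigma>] show ?thesis by (rule order_trans)
  qed
  \<comment> \<open>The best iid profile is itself admissible, so it also serves as the minimizing
    \<sigma> and the two minima agree.\<close>
  moreover have "iid n X \<in> {..<n} \<rightarrow>\<^sub>E ?D"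
    using X by (simp add: iid_def)
  ultimately show ?thesis
    using X min by (intro exI[of _ "iid n X"] exI[of _ X]) (auto simp: is_arg_min_linorder)
qed

end
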